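(* Let $\alpha>0$ and $\lambda>0$, let $n$ be the smallest integer greater than or equal to $\alpha$, and let $m\ge n$ be an integer. Then for all $t>0$, $$\mathcal{D}^{\alpha}B_m(t\mid\lambda)=\frac{\Gamma(m+1)}{\Gamma(m-n+1)}\sum_{k=0}^{m-n}\frac{k!\binom{m-n}{k}B_{m-n-k}(\lambda)}{\Gamma(n+k-\alpha+1)}\,t^{k-\alpha+n}.$$
   Context: The Apostol-Bernoulli polynomials $B_m(t\mid\lambda)$ are defined by the power series expansion at $z=0$ $$\frac{z}{\lambda e^{z}-1}e^{tz}=\sum_{m=0}^{\infty}B_m(t\mid\lambda)\frac{z^m}{m!},$$ and $B_m(\lambda):=B_m(0\mid\lambda)$. For $\alpha>0$ and $n$ the smallest integer $\ge\alpha$, the Caputo fractional derivative of order $\alpha$ of a function $f:(0,\infty)\to\mathbb{R}$ is $$\mathcal{D}^{\alpha}f(t)=\frac{1}{\Gamma(n-\alpha)}\int_{0}^{t}\frac{f^{(n)}(s)}{(t-s)^{\alpha-n+1}}\,ds,$$ with the usual convention $\mathcal{D}^{\alpha}f=f^{(n)}$ when $\alpha=n$ is an integer. In the claim, $\mathcal{D}^{\alpha}$ acts in the variable $t$. *)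

theory Defs
  imports "HOL-Analysis.Analysis"
begin

text \<open>
  Coefficients of the expansion of \<open>z / (lam * exp z - 1) * exp (t * z)\<close> at \<open>z = 0\<close>. For
  \<open>lam = 1\<close> the denominator vanishes to order one at \<open>0\<close>, and division of formal power
  series over a field cancels the common factor \<^const>\<open>fps_X\<close>. The lemma
  \<open>apostol_bernoulli_sums\<close> below gives the analytic form.
\<close>

definition apostol_bernoulli_fps :: "real \<Rightarrow> real \<Rightarrow> real fps" where
  "apostol_bernoulli_fps t lam = fps_X / (fps_const lam * fps_exp 1 - 1) * fps_exp t"

definition apostol_bernpoly :: "nat \<Rightarrow> real \<Rightarrow> real \<Rightarrow> real" where
  "apostol_bernpoly m t lam = fact m * fps_nth (apostol_bernoulli_fps t lam) m"

definition apostol_bernoulli :: "nat \<Rightarrow> real \<Rightarrow> real" where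
  "apostol_bernoulli m lam = apostol_bernpoly m 0 lam"

lemma apostol_bernoulli_sums:
  fixes t lam :: real
  shows "eventually (\<lambda>z. (\<lambda>m. apostol_bernpoly m t lam * z ^ m / fact m) sums
           (z / (lam * exp z - 1) * exp (t * z))) (at 0)"
proof -
  define D :: "real fps" where "D = fps_const lam * fps_exp 1 - 1"
  define c where "c = fps_nth fps_X (subdegree D) / fps_nth D (subdegree D)"
  have nth: "fps_nth D 0 = lam - 1" "fps_nth D 1 = lam"
    by (simp_all add: D_def)
  have sub: "subdegree D \<le> subdegree (fps_X :: real fps)" and D0: "D \<noteq> 0"
  proof -
    have "fps_nth D 0 \<noteq> 0 \<or> fps_nth D 1 \<noteq> 0"
      using nth by auto
    then show "subdegree D \<le> subdegree (fps_X :: real fps)" "D \<noteq> 0"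
      using subdegree_leI[of D 0] subdegree_leI[of D 1] by auto
  qed
  have DE: "(\<lambda>z. lam * exp (1 * z) - 1) has_fps_expansion D"
    unfolding D_def by (intro fps_expansion_intros)
  have "(\<lambda>z. if z = 0 then c else z / (lam * exp (1 * z) - 1)) has_fps_expansion fps_X / D"
    by (rule has_fps_expansion_divide[OF _ DE sub D0]) (auto intro: fps_expansion_intros simp: c_def)
  then have "(\<lambda>z. (if z = 0 then c else z / (lam * exp (1 * z) - 1)) * exp (t * z))
               has_fps_expansion apostol_bernoulli_fps t lam"
    unfolding apostol_bernoulli_fps_def D_def[symmetric]
    by (rule has_fps_expansion_mult[OF _ has_fps_expansion_exp])
  then have ev: "eventually (\<lambda>z. z \<in> eball 0 (fps_conv_radius (apostol_bernoulli_fps t lam)) \<and>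
      eval_fps (apostol_bernoulli_fps t lam) z =
        (if z = 0 then c else z / (lam * exp (1 * z) - 1)) * exp (t * z)) (nhds 0)"
    unfolding has_fps_expansion_def
    by (intro eventually_conj eventually_nhds_in_open) (auto simp: zero_ereal_def)
  show ?thesis
    unfolding eventually_at_filter
    using ev
  proof eventually_elim
    case (elim z)
    then have "(\<lambda>m. fps_nth (apostol_bernoulli_fps t lam) m * z ^ m) sums
        eval_fps (apostol_bernoulli_fps t lam) z"
      by (intro sums_eval_fps) (auto simp: in_eball_iff)
    with elim show ?case
      by (auto simp: apostol_bernpoly_def)
  qed
qed

definition caputo_deriv :: "real \<Rightarrow> (real \<Rightarrow> real) \<Rightarrow> real \<Rightarrow> real" where
  "caputo_deriv \<alpha> f t =
    (let n = nat \<lceil>\<alpha>\<rceil> in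
     if \<alpha> = real n then (deriv ^^ n) f t
     else 1 / Gamma (real n - \<alpha>) *
       (LBINT s:{0<..<t}. (deriv ^^ n) f s / (t - s) powr (\<alpha> - real n + 1)))"

end

theory Submission
  imports Defs
begin

text \<open>
  The factor \<open>exp (t * z)\<close> in the generating function makes the Apostol-Bernoulli polynomials
  satisfy the Appell relation: multiplying a power series by \<open>exp (t * z)\<close> gives
  \<open>B\<^sub>m(t) = (\<Sum>k\<le>m. (m choose k) B\<^bsub>m-k\<^esub> t\<^sup>k)\<close>, so \<open>B\<^sub>m' = m B\<^bsub>m-1\<^esub>\<close>
  (\<open>has_real_derivative_apostol_bernpoly\<close>). The \<open>n\<close>-th derivative of \<open>B\<^sub>m\<close> is
  therefore \<open>m! / (m - n)!\<close> times \<open>B\<^bsub>m-n\<^esub>\<close>, which is again a polynomial in \<open>t\<close> with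
  known coefficients.

  What remains of the Caputo derivative is a fractional integral of order \<open>n - \<alpha>\<close> of a
  polynomial. On a monomial it is an Euler Beta integral rescaled from \<open>{0<..<1}\<close> to
  \<open>{0<..<t}\<close> (\<open>has_bochner_integral_Beta_scaled\<close>), so that \<open>s\<^sup>k\<close> is sent to
  \<open>k! / \<Gamma>(n + k - \<alpha> + 1)\<close> times \<open>t powr (k + n - \<alpha>)\<close>; the factor \<open>\<Gamma>(n - \<alpha>)\<close> of the
  Beta function cancels the one in the definition of the derivative. For integer \<open>\<alpha>\<close> there is no
  integral, but then the same formula reads \<open>s\<^sup>k \<mapsto> t\<^sup>k\<close>, and so both cases are covered by
  \<open>caputo_deriv_polynomial\<close>.
\<close>

lemma apostol_bernpoly_expansion:
  "apostol_bernpoly m t lam = (\<Sum>k\<le>m. real (m choose k) * apostol_bernoulli (m - k) lam * t ^ k)"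
proof -
  define A where "A = fps_X / (fps_const lam * fps_exp 1 - 1)"
  have number: "apostol_bernoulli i lam = fact i * fps_nth A i" for i
    by (simp add: apostol_bernoulli_def apostol_bernpoly_def apostol_bernoulli_fps_def A_def)
  have "apostol_bernpoly m t lam = fact m * fps_nth (fps_exp t * A) m"
    by (simp add: apostol_bernpoly_def apostol_bernoulli_fps_def A_def mult.commute)
  also have "\<dots> = (\<Sum>k\<le>m. fact m * (t ^ k / fact k * fps_nth A (m - k)))"
    by (simp add: fps_mult_nth sum_distrib_left atLeast0AtMost)
  also have "\<dots> = (\<Sum>k\<le>m. real (m choose k) * apostol_bernoulli (m - k) lam * t ^ k)"
    by (intro sum.cong refl) (simp add: number binomial_fact field_simps)
  finally show ?thesis .
qed

text \<open>
  The Appell relation. Differentiating the expansion termwise, the absorption identity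
  \<open>(k + 1) (m + 1 choose k + 1) = (m + 1) (m choose k)\<close> pulls out the factor \<open>m + 1\<close>.
\<close>

lemma has_real_derivative_apostol_bernpoly:
  "((\<lambda>s. apostol_bernpoly (Suc m) s lam) has_real_derivative
     real (Suc m) * apostol_bernpoly m t lam) (at t)"
proof -
  have expansion: "apostol_bernpoly (Suc m) s lam = apostol_bernoulli (Suc m) lam +
      (\<Sum>k\<le>m. real (Suc m choose Suc k) * apostol_bernoulli (m - k) lam * s ^ Suc k)" for s
    unfolding apostol_bernpoly_expansion[of "Suc m"] by (subst sum.atMost_Suc_shift) simp
  have absorb: "real (Suc m choose Suc k) * (1 + real k) = real (Suc m) * real (m choose k)" for k
    using Suc_times_binomial[of k m] by (metis mult.commute of_nat_Suc of_nat_mult)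
  have "((\<lambda>s. apostol_bernpoly (Suc m) s lam) has_real_derivative
      (\<Sum>k\<le>m. real (Suc m choose Suc k) * apostol_bernoulli (m - k) lam * ((1 + real k) * t ^ k)))
      (at t)"
  proof -
    have "((\<lambda>s. s ^ Suc k) has_real_derivative (1 + real k) * t ^ k) (at t)" for k
      using DERIV_pow[of "Suc k" t] by simp
    then have "((\<lambda>s. apostol_bernpoly (Suc m) s lam) has_real_derivative 0 +
        (\<Sum>k\<le>m. real (Suc m choose Suc k) * apostol_bernoulli (m - k) lam * ((1 + real k) * t ^ k)))
        (at t)"
      unfolding expansion by (intro DERIV_add DERIV_const DERIV_sum DERIV_cmult)
    then show ?thesis
      by simp
  qed
  also have "(\<Sum>k\<le>m. real (Suc m choose Suc k) * apostol_bernoulli (m - k) lam *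
        ((1 + real k) * t ^ k)) =
      (\<Sum>k\<le>m. real (Suc m choose Suc k) * (1 + real k) * (apostol_bernoulli (m - k) lam * t ^ k))"
    by (simp only: mult_ac)
  also have "\<dots> = real (Suc m) * apostol_bernpoly m t lam"
    by (simp only: absorb apostol_bernpoly_expansion[of m] sum_distrib_left mult.assoc)
  finally show ?thesis .
qed

lemma higher_deriv_apostol_bernpoly:
  assumes "n \<le> m"
  shows "(deriv ^^ n) (\<lambda>s. apostol_bernpoly m s lam) =
           (\<lambda>s. fact m / fact (m - n) * apostol_bernpoly (m - n) s lam)"
  using assms
proof (induction n)
  case 0
  then show ?case by simp
next
  case (Suc n)
  then obtain j where j: "m - n = Suc j" "m - Suc n = j"
    by (metis Suc_diff_Suc Suc_le_lessD)
  have "deriv (\<lambda>s. fact m / fact (Suc j) * apostol_bernpoly (Suc j) s lam) =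
          (\<lambda>t. fact m / fact j * apostol_bernpoly j t lam)"
  proof
    fix t
    have "deriv (\<lambda>s. fact m / fact (Suc j) * apostol_bernpoly (Suc j) s lam) t =
        fact m / fact (Suc j) * (real (Suc j) * apostol_bernpoly j t lam)"
      by (intro DERIV_imp_deriv DERIV_cmult has_real_derivative_apostol_bernpoly)
    then show "deriv (\<lambda>s. fact m / fact (Suc j) * apostol_bernpoly (Suc j) s lam) t =
        fact m / fact j * apostol_bernpoly j t lam"
      by (simp add: divide_simps)
  qed
  moreover have "(deriv ^^ n) (\<lambda>s. apostol_bernpoly m s lam) =
      (\<lambda>s. fact m / fact (Suc j) * apostol_bernpoly (Suc j) s lam)"
    using Suc j by simp
  ultimately show ?case
    unfolding funpow.simps(2) o_apply j(2) by simp
qed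

text \<open>
  The substitution \<open>s = t * x\<close> turns the Beta integral over \<open>{0<..<1}\<close> into the convolution of
  two powers over \<open>{0<..<t}\<close>, and the powers of \<open>t\<close> collect to \<open>t powr (a + b - 1)\<close>.
\<close>

lemma has_bochner_integral_Beta_scaled:
  fixes a b t :: real
  assumes "a > 0" "b > 0" "t > 0"
  shows "has_bochner_integral lborel
           (\<lambda>s. indicator {0<..<t} s * (s powr (a - 1) * (t - s) powr (b - 1)))
           (Beta a b * t powr (a + b - 1))"
proof -
  let ?g = "\<lambda>x. x powr (a - 1) * (1 - x) powr (b - 1)"
  define f where "f = (\<lambda>x. indicator {0<..<1} x * ?g x)"
  have int: "set_integrable lborel {0<..<1} ?g"
    by (rule set_integrable_subset[OF integrable_Beta[OF assms(1,2)]]) auto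
  have "(?g has_integral Beta a b) {0<..<1}"
    using has_integral_Beta_real[OF assms(1,2)] by (simp add: has_integral_Icc_iff_Ioo)
  then have "(LBINT x:{0<..<1}. ?g x) = Beta a b"
    using set_borel_integral_eq_integral(2)[OF int] by (simp add: integral_unique)
  then have "has_bochner_integral lborel f (Beta a b)"
    using int by (simp add: f_def has_bochner_integral_iff set_integrable_def
        set_lebesgue_integral_def)
  then have "has_bochner_integral lborel (\<lambda>s. f (0 + inverse t * s)) (Beta a b /\<^sub>R \<bar>inverse t\<bar>)"
    using assms by (subst (asm) lborel_has_bochner_integral_real_affine_iff[of "inverse t" _ _ 0]) auto
  \<comment> \<open>The factor \<open>t powr (a + b - 2)\<close> clears the denominators of \<open>s / t\<close> and \<open>1 - s / t\<close>.\<close>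
  then have "has_bochner_integral lborel (\<lambda>s. t powr (a + b - 2) * f (0 + inverse t * s))
      (t powr (a + b - 2) * (Beta a b /\<^sub>R \<bar>inverse t\<bar>))"
    by (rule has_bochner_integral_mult_right)
  moreover have "t powr (a + b - 2) * f (0 + inverse t * s) =
      indicator {0<..<t} s * (s powr (a - 1) * (t - s) powr (b - 1))" for s
  proof (cases "s \<in> {0<..<t}")
    case True
    have "1 - s / t = (t - s) / t"
      using assms by (simp add: field_simps)
    moreover have "t powr (a + b - 2) = t powr (a - 1) * t powr (b - 1)"
      by (simp flip: powr_add)
    ultimately show ?thesis
      using True assms by (simp add: f_def divide_inverse_commute[symmetric] powr_divide)
  next
    case False
    then show ?thesis
      using assms by (auto simp: f_def indicator_def field_simps)
  qed
  moreover have "t powr (a + b - 2) * (Beta a b /\<^sub>R \<bar>inverse t\<bar>) = Beta a b * t powr (a + b - 1)"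
    using assms powr_mult_base[of t "a + b - 2"] by (simp add: mult_ac)
  ultimately show ?thesis
    by (simp only:)
qed

text \<open>
  The function enters the Caputo derivative only through its \<open>n\<close>-th derivative, so it is the latter
  that is prescribed. Each monomial in it contributes a Beta integral with \<open>a = k + 1\<close> and
  \<open>b = n - \<alpha>\<close>, which is positive unless \<open>\<alpha> = n\<close>.
\<close>

lemma caputo_deriv_polynomial:
  fixes c :: "nat \<Rightarrow> real"
  assumes "t > 0" and n: "n = nat \<lceil>\<alpha>\<rceil>"
    and deriv: "\<And>s. (deriv ^^ n) f s = (\<Sum>k\<in>K. c k * s ^ k)"
  shows "caputo_deriv \<alpha> f t =
    (\<Sum>k\<in>K. c k * (fact k / Gamma (real n + real k - \<alpha> + 1) * t powr (real k - \<alpha> + real n)))"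
proof (cases "\<alpha> = real n")
  case True
  have "fact k / Gamma (real n + real k - \<alpha> + 1) * t powr (real k - \<alpha> + real n) = t ^ k" for k
    using True assms Gamma_fact[of k, where 'a = real] by (simp add: powr_realpow add.commute)
  then show ?thesis
    unfolding caputo_deriv_def Let_def n[symmetric] if_P[OF True] deriv by (simp only:)
next
  case False
  define b where "b = real n - \<alpha>"
  have "\<alpha> \<le> real n"
    unfolding n by (rule real_nat_ceiling_ge)
  with False have "b > 0"
    by (simp add: b_def)
  define I where "I = (\<lambda>k. Beta (real k + 1) b * t powr (real k + b))"
  have monomial: "has_bochner_integral lborel
      (\<lambda>s. indicator {0<..<t} s * (s powr real k * (t - s) powr (b - 1))) (I k)" for k
    using has_bochner_integral_Beta_scaled[of "real k + 1" b t] \<open>b > 0\<close> \<open>t > 0\<close>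
    by (simp add: I_def add.commute)
  have "has_bochner_integral lborel
      (\<lambda>s. \<Sum>k\<in>K. c k * (indicator {0<..<t} s * (s powr real k * (t - s) powr (b - 1))))
      (\<Sum>k\<in>K. c k * I k)"
    by (intro has_bochner_integral_sum has_bochner_integral_mult_right monomial)
  moreover have "(\<Sum>k\<in>K. c k * (indicator {0<..<t} s * (s powr real k * (t - s) powr (b - 1)))) =
      indicator {0<..<t} s *\<^sub>R ((deriv ^^ n) f s / (t - s) powr (\<alpha> - real n + 1))" for s
  proof (cases "s \<in> {0<..<t}")
    case True
    have "\<alpha> - real n + 1 = - (b - 1)"
      by (simp add: b_def)
    then have "inverse ((t - s) powr (\<alpha> - real n + 1)) = (t - s) powr (b - 1)"
      by (simp only: powr_minus inverse_inverse_eq)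
    then show ?thesis
      using True by (simp add: deriv powr_realpow divide_inverse sum_distrib_left mult_ac)
  qed simp
  ultimately have "(LBINT s:{0<..<t}. (deriv ^^ n) f s / (t - s) powr (\<alpha> - real n + 1)) =
      (\<Sum>k\<in>K. c k * I k)"
    by (simp add: set_lebesgue_integral_def has_bochner_integral_integral_eq)
  then have "caputo_deriv \<alpha> f t = (\<Sum>k\<in>K. c k * (1 / Gamma b * I k))"
    unfolding caputo_deriv_def Let_def n[symmetric] if_not_P[OF False]
    by (simp add: b_def sum_distrib_left)
  moreover have "1 / Gamma b * I k =
      fact k / Gamma (real n + real k - \<alpha> + 1) * t powr (real k - \<alpha> + real n)" for k
  proof -
    have "Gamma b \<noteq> 0"
      using Gamma_real_pos[OF \<open>b > 0\<close>] by simp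
    moreover have "Gamma (real k + 1) = fact k"
      using Gamma_fact[of k] by (simp add: add.commute)
    moreover have "real n + real k - \<alpha> + 1 = real k + 1 + b" "real k - \<alpha> + real n = real k + b"
      by (simp_all add: b_def)
    ultimately show ?thesis
      by (simp only: I_def Beta_def) simp
  qed
  ultimately show ?thesis
    by (simp only:)
qed

theorem theorem4:
  fixes \<alpha> lam :: real and n m :: nat
  assumes "\<alpha> > 0" and "lam > 0"
    and "n = nat \<lceil>\<alpha>\<rceil>"
    and "m \<ge> n"
  shows "\<forall>t::real. t > 0 \<longrightarrow>
    caputo_deriv \<alpha> (\<lambda>s. apostol_bernpoly m s lam) t =
      Gamma (real m + 1) / Gamma (real m - real n + 1) *
      (\<Sum>k=0..m-n. fact k * real ((m - n) choose k) * apostol_bernoulli (m - n - k) lam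
          / Gamma (real n + real k - \<alpha> + 1) * t powr (real k - \<alpha> + real n))"
proof (intro allI impI)
  fix t :: real
  assume "t > 0"
  define C where "C = Gamma (real m + 1) / Gamma (real m - real n + 1)"
  define c where "c = (\<lambda>k. C * (real ((m - n) choose k) * apostol_bernoulli (m - n - k) lam))"
  have C: "C = fact m / fact (m - n)"
    using Gamma_fact[of m, where 'a = real] Gamma_fact[of "m - n", where 'a = real] \<open>m \<ge> n\<close>
    by (simp add: C_def add.commute)
  have "(deriv ^^ n) (\<lambda>s. apostol_bernpoly m s lam) s = (\<Sum>k=0..m-n. c k * s ^ k)" for s
    unfolding higher_deriv_apostol_bernpoly[OF \<open>m \<ge> n\<close>] apostol_bernpoly_expansion[of "m - n"]
    by (simp add: c_def C sum_distrib_left atLeast0AtMost mult_ac)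
  from caputo_deriv_polynomial[OF \<open>t > 0\<close> \<open>n = nat \<lceil>\<alpha>\<rceil>\<close> this]
  show "caputo_deriv \<alpha> (\<lambda>s. apostol_bernpoly m s lam) t =
      Gamma (real m + 1) / Gamma (real m - real n + 1) *
      (\<Sum>k=0..m-n. fact k * real ((m - n) choose k) * apostol_bernoulli (m - n - k) lam
          / Gamma (real n + real k - \<alpha> + 1) * t powr (real k - \<alpha> + real n))"
    by (simp add: c_def C_def[symmetric] sum_distrib_left mult_ac)
qed

end
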